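(* Let $(K,A,\circ)$ be a crossed semi-bimodule such that $K$ and $A$ are groups. Put $\partial(x)=1\circ x$, let $K^{tw}$ be the set $K$ with the group operation $x\diamond y=y\,x^{\partial(y)}$, and consider the crossed module $\partial:K^{tw}\to A$ with right action $x^{*a}={}^{a^{-1}}x^{a}$. Let $(K^{tw},A,\circ_{tw})$ be the crossed semi-bimodule corresponding to this crossed module, i.e. with trivial left action of $A$ on $K^{tw}$, right action $x^{*a}$, and $a\circ_{tw}x=a\,\partial(x)$. Then the maps $\mathrm{Id}:A\to A$ and $\gamma:A\times K^{tw}\to K$, $\gamma(a,x)={}^{a}x$, define a weak isomorphism $(K^{tw},A,\circ_{tw})\to(K,A,\circ)$.
   Context: A crossed semi-bimodule $(K,A,\circ)$ consists of monoids $A$ and $K$ (written multiplicatively, units denoted $1$), together with maps $A\times K\to A,\ (a,x)\mapsto a\circ x$; $A\times K\to K,\ (a,x)\mapsto {}^{a}x$; $K\times A\to K,\ (x,a)\mapsto x^{a}$, such that: the first map makes $A$ into a right $K$-set ($a\circ 1=a$, $a\circ(xy)=(a\circ x)\circ y$); the second makes $K$ into a left $A$-monoid (a left action of $A$ on $K$ by monoid endomorphisms: ${}^{1}x=x$, ${}^{ab}x={}^{a}({}^{b}x)$, ${}^{a}(xy)={}^{a}x\,{}^{a}y$, ${}^{a}1=1$); the third makes $K$ into a right $A$-monoid ($x^{1}=x$, $x^{ab}=(x^{a})^{b}$, $(xy)^{a}=x^{a}y^{a}$, $1^{a}=1$); and for all $x,y\in K$, $a,b\in A$: (1) $({}^{a}x)^{b}={}^{a}(x^{b})$;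 (2) $(ab)\circ({}^{a}x)=a(b\circ x)$; (3) $(ab)\circ(x^{b})=(a\circ x)b$; (4) $({}^{a}y)\,x^{b\circ y}=x^{b}\,({}^{a\circ x}y)$. A crossed module is a group homomorphism $\partial:G\to A$ with a right action $x^a$ of the group $A$ on the group $G$ such that $\partial(x^{a})=a^{-1}\partial(x)a$ and $y^{\partial x}=x^{-1}yx$ for all $x,y\in G$, $a\in A$. When $K$ and $A$ are groups, $K^{tw}$ is a group and $\partial:K^{tw}\to A$ with the action $x^{*a}$ is a crossed module. A weak morphism from a crossed semi-bimodule $(K,A,\circ)$ to a crossed semi-bimodule $(K',A',\circ)$ is a pair $(\kappa,\gamma)$ of a monoid homomorphism $\kappa:A\to A'$ and a map $\gamma:A\times K\to K'$ such that for all $a,b\in A$, $x,y\in K$: (w1) $\gamma(a,xy)=\gamma(a,x)\,\gamma(a,y)$; (w2) $\kappa(a)\circ\gamma(a,x)=\kappa(a\circ x)$; (w3) ${}^{\kappa(a)}\gamma(b,y)\;\gamma(a,x)^{\kappa(b)\circ\gamma(b,y)}=\gamma(ab,\ {}^{a}y\,x^{b\circ y})$. Weak morphisms compose by $(\kappa',\gamma')\circ(\kappa,\gamma)=(\kappa'\kappa,\gamma'')$ with $\gamma''(a,x)=\gamma'(\kappa(a),\gamma(a,x))$; the identity of $(K,A,\circ)$ is $(\mathrm{Id}_A,(a,x)\mapsto x)$. Weak isomorphisms are the isomorphisms in the category of crossed semi-bimodules and weak morphisms.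
   Formalization: In the definition of weak morphism, law (w1) is corrected from γ(a,xy)=γ(a,x)γ(a,y) to γ(a,xy)=γ(a,x)γ(a∘x,y); with the printed law the claim fails, e.g. for A nonabelian, K=A^op, ^a x=axa⁻¹, x^a=x, a∘x=xa. *)

theory Defs
  imports "HOL-Algebra.Group"
begin

text \<open>
  Monoids and groups are the carrier-based structures of \<open>HOL-Algebra\<close>.  In particular
  \<open>K\<close> and its twist are two group structures on the same carrier.
\<close>

definition right_set :: "'k monoid \<Rightarrow> 'a set \<Rightarrow> ('a \<Rightarrow> 'k \<Rightarrow> 'a) \<Rightarrow> bool" where
  "right_set K S f \<longleftrightarrow>
     (\<forall>a\<in>S. \<forall>x\<in>carrier K. f a x \<in> S) \<and>
     (\<forall>a\<in>S. f a \<one>\<^bsub>K\<^esub> = a) \<and>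
     (\<forall>a\<in>S. \<forall>x\<in>carrier K. \<forall>y\<in>carrier K. f a (x \<otimes>\<^bsub>K\<^esub> y) = f (f a x) y)"

definition left_monoid_action :: "'a monoid \<Rightarrow> 'k monoid \<Rightarrow> ('a \<Rightarrow> 'k \<Rightarrow> 'k) \<Rightarrow> bool" where
  "left_monoid_action A K l \<longleftrightarrow>
     (\<forall>a\<in>carrier A. \<forall>x\<in>carrier K. l a x \<in> carrier K) \<and>
     (\<forall>x\<in>carrier K. l \<one>\<^bsub>A\<^esub> x = x) \<and>
     (\<forall>a\<in>carrier A. \<forall>b\<in>carrier A. \<forall>x\<in>carrier K. l (a \<otimes>\<^bsub>A\<^esub> b) x = l a (l b x)) \<and>
     (\<forall>a\<in>carrier A. \<forall>x\<in>carrier K. \<forall>y\<in>carrier K. l a (x \<otimes>\<^bsub>K\<^esub> y) = l a x \<otimes>\<^bsub>K\<^esub> l a y) \<and>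
     (\<forall>a\<in>carrier A. l a \<one>\<^bsub>K\<^esub> = \<one>\<^bsub>K\<^esub>)"

definition right_monoid_action :: "'a monoid \<Rightarrow> 'k monoid \<Rightarrow> ('k \<Rightarrow> 'a \<Rightarrow> 'k) \<Rightarrow> bool" where
  "right_monoid_action A K r \<longleftrightarrow>
     (\<forall>a\<in>carrier A. \<forall>x\<in>carrier K. r x a \<in> carrier K) \<and>
     (\<forall>x\<in>carrier K. r x \<one>\<^bsub>A\<^esub> = x) \<and>
     (\<forall>a\<in>carrier A. \<forall>b\<in>carrier A. \<forall>x\<in>carrier K. r x (a \<otimes>\<^bsub>A\<^esub> b) = r (r x a) b) \<and>
     (\<forall>a\<in>carrier A. \<forall>x\<in>carrier K. \<forall>y\<in>carrier K. r (x \<otimes>\<^bsub>K\<^esub> y) a = r x a \<otimes>\<^bsub>K\<^esub> r y a) \<and>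
     (\<forall>a\<in>carrier A. r \<one>\<^bsub>K\<^esub> a = \<one>\<^bsub>K\<^esub>)"

text \<open>
  In the structure \<open>X = (K, A, \<circ>)\<close> the map \<open>a \<circ> x\<close> is written \<open>a \<odot> x\<close>,
  the left action of \<open>a\<close> on \<open>x\<close> is \<open>a \<triangleright> x\<close>, and the right action
  of \<open>a\<close> on \<open>x\<close> is \<open>x \<triangleleft> a\<close>, indexed by \<open>X\<close> where needed.
\<close>

record ('a, 'k) semi_bimodule =
  csb_K :: "'k monoid"
  csb_A :: "'a monoid"
  csb_circ :: "'a \<Rightarrow> 'k \<Rightarrow> 'a" (infixl "\<odot>\<index>" 75)
  csb_left :: "'a \<Rightarrow> 'k \<Rightarrow> 'k" (infixr "\<triangleright>\<index>" 80)
  csb_right :: "'k \<Rightarrow> 'a \<Rightarrow> 'k" (infixl "\<triangleleft>\<index>" 81)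

locale crossed_semi_bimodule =
  fixes X :: "('a, 'k) semi_bimodule" (structure)
    and K :: "'k monoid" and A :: "'a monoid"
  defines "K \<equiv> csb_K X" and "A \<equiv> csb_A X"
  assumes monoid_K: "monoid K"
    and monoid_A: "monoid A"
    and circ_right_set: "right_set K (carrier A) (csb_circ X)"
    and left_action: "left_monoid_action A K (csb_left X)"
    and right_action: "right_monoid_action A K (csb_right X)"
    and actions_commute:
      "\<lbrakk>a \<in> carrier A; b \<in> carrier A; x \<in> carrier K\<rbrakk> \<Longrightarrow>
         (a \<triangleright> x) \<triangleleft> b = a \<triangleright> (x \<triangleleft> b)"
    and circ_left:
      "\<lbrakk>a \<in> carrier A; b \<in> carrier A; x \<in> carrier K\<rbrakk> \<Longrightarrow>
         (a \<otimes>\<^bsub>A\<^esub> b) \<odot> (a \<triangleright> x) = a \<otimes>\<^bsub>A\<^esub> (b \<odot> x)"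
    and circ_right:
      "\<lbrakk>a \<in> carrier A; b \<in> carrier A; x \<in> carrier K\<rbrakk> \<Longrightarrow>
         (a \<otimes>\<^bsub>A\<^esub> b) \<odot> (x \<triangleleft> b) = (a \<odot> x) \<otimes>\<^bsub>A\<^esub> b"
    and interchange:
      "\<lbrakk>a \<in> carrier A; b \<in> carrier A; x \<in> carrier K; y \<in> carrier K\<rbrakk> \<Longrightarrow>
         (a \<triangleright> y) \<otimes>\<^bsub>K\<^esub> (x \<triangleleft> (b \<odot> y)) = (x \<triangleleft> b) \<otimes>\<^bsub>K\<^esub> ((a \<odot> x) \<triangleright> y)"

definition crossed_module ::
    "'g monoid \<Rightarrow> 'a monoid \<Rightarrow> ('g \<Rightarrow> 'a) \<Rightarrow> ('g \<Rightarrow> 'a \<Rightarrow> 'g) \<Rightarrow> bool" where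
  "crossed_module G A \<delta> r \<longleftrightarrow>
     group G \<and> group A \<and> \<delta> \<in> hom G A \<and> right_monoid_action A G r \<and>
     (\<forall>x\<in>carrier G. \<forall>a\<in>carrier A. \<delta> (r x a) = inv\<^bsub>A\<^esub> a \<otimes>\<^bsub>A\<^esub> \<delta> x \<otimes>\<^bsub>A\<^esub> a) \<and>
     (\<forall>x\<in>carrier G. \<forall>y\<in>carrier G. r y (\<delta> x) = inv\<^bsub>G\<^esub> x \<otimes>\<^bsub>G\<^esub> y \<otimes>\<^bsub>G\<^esub> x)"

definition csb_of_crossed_module ::
    "'g monoid \<Rightarrow> 'a monoid \<Rightarrow> ('g \<Rightarrow> 'a) \<Rightarrow> ('g \<Rightarrow> 'a \<Rightarrow> 'g) \<Rightarrow> ('a, 'g) semi_bimodule" where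
  "csb_of_crossed_module G A \<delta> r =
     \<lparr>csb_K = G, csb_A = A, csb_circ = (\<lambda>a x. a \<otimes>\<^bsub>A\<^esub> \<delta> x),
      csb_left = (\<lambda>a x. x), csb_right = r\<rparr>"

definition csb_boundary :: "('a, 'k) semi_bimodule \<Rightarrow> 'k \<Rightarrow> 'a" where
  "csb_boundary X x = \<one>\<^bsub>csb_A X\<^esub> \<odot>\<^bsub>X\<^esub> x"

definition csb_twist :: "('a, 'k) semi_bimodule \<Rightarrow> 'k monoid" where
  "csb_twist X =
     \<lparr>carrier = carrier (csb_K X),
      mult = (\<lambda>x y. y \<otimes>\<^bsub>csb_K X\<^esub> (x \<triangleleft>\<^bsub>X\<^esub> csb_boundary X y)),
      one = \<one>\<^bsub>csb_K X\<^esub>\<rparr>"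

definition csb_twist_action :: "('a, 'k) semi_bimodule \<Rightarrow> 'k \<Rightarrow> 'a \<Rightarrow> 'k" where
  "csb_twist_action X x a = (inv\<^bsub>csb_A X\<^esub> a) \<triangleright>\<^bsub>X\<^esub> (x \<triangleleft>\<^bsub>X\<^esub> a)"

text \<open>
  A pair of functions represents a morphism; only its values on the carriers matter
  (see \<open>weak_eq\<close> below).

  The first law below is \<open>\<gamma>(a, xy) = \<gamma>(a, x) \<gamma>(a \<circ> x, y)\<close>: reading
  \<open>x\<close> as an arrow \<open>a \<rightarrow> a \<circ> x\<close>, it says that \<open>\<kappa>\<close> and \<open>\<gamma>\<close>
  form a functor.  The version \<open>\<gamma>(a, xy) = \<gamma>(a, x) \<gamma>(a, y)\<close> is a misprint: with it,
  \<open>\<gamma>(a, x) = a \<triangleright> x\<close> need not be a weak morphism from the twist, since for \<open>a = 1\<close> it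
  would force \<open>y (x \<triangleleft> \<partial> y) = x y\<close> in \<open>K\<close>.  This fails for a nonabelian group \<open>A\<close>
  with \<open>K\<close> the opposite group, left action by conjugation in \<open>A\<close>, trivial right action,
  and \<open>a \<odot> x = x a\<close> (product in \<open>A\<close>).
\<close>

definition weak_morphism ::
    "('a, 'k) semi_bimodule \<Rightarrow> ('b, 'l) semi_bimodule \<Rightarrow> ('a \<Rightarrow> 'b) \<times> ('a \<Rightarrow> 'k \<Rightarrow> 'l) \<Rightarrow> bool"
  where
  "weak_morphism X Y = (\<lambda>(\<kappa>, \<gamma>).
     crossed_semi_bimodule X \<and> crossed_semi_bimodule Y \<and>
     \<kappa> \<in> hom (csb_A X) (csb_A Y) \<and> \<kappa> \<one>\<^bsub>csb_A X\<^esub> = \<one>\<^bsub>csb_A Y\<^esub> \<and>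
     (\<forall>a\<in>carrier (csb_A X). \<forall>x\<in>carrier (csb_K X). \<gamma> a x \<in> carrier (csb_K Y)) \<and>
     (\<forall>a\<in>carrier (csb_A X). \<forall>x\<in>carrier (csb_K X). \<forall>y\<in>carrier (csb_K X).
        \<gamma> a (x \<otimes>\<^bsub>csb_K X\<^esub> y) = \<gamma> a x \<otimes>\<^bsub>csb_K Y\<^esub> \<gamma> (a \<odot>\<^bsub>X\<^esub> x) y) \<and>
     (\<forall>a\<in>carrier (csb_A X). \<forall>x\<in>carrier (csb_K X).
        \<kappa> a \<odot>\<^bsub>Y\<^esub> \<gamma> a x = \<kappa> (a \<odot>\<^bsub>X\<^esub> x)) \<and>
     (\<forall>a\<in>carrier (csb_A X). \<forall>b\<in>carrier (csb_A X).
      \<forall>x\<in>carrier (csb_K X). \<forall>y\<in>carrier (csb_K X).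
        (\<kappa> a \<triangleright>\<^bsub>Y\<^esub> \<gamma> b y) \<otimes>\<^bsub>csb_K Y\<^esub> (\<gamma> a x \<triangleleft>\<^bsub>Y\<^esub> (\<kappa> b \<odot>\<^bsub>Y\<^esub> \<gamma> b y)) =
        \<gamma> (a \<otimes>\<^bsub>csb_A X\<^esub> b) ((a \<triangleright>\<^bsub>X\<^esub> y) \<otimes>\<^bsub>csb_K X\<^esub> (x \<triangleleft>\<^bsub>X\<^esub> (b \<odot>\<^bsub>X\<^esub> y)))))"

definition weak_comp ::
    "('b \<Rightarrow> 'c) \<times> ('b \<Rightarrow> 'l \<Rightarrow> 'm) \<Rightarrow> ('a \<Rightarrow> 'b) \<times> ('a \<Rightarrow> 'k \<Rightarrow> 'l) \<Rightarrow>
     ('a \<Rightarrow> 'c) \<times> ('a \<Rightarrow> 'k \<Rightarrow> 'm)" where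
  "weak_comp = (\<lambda>(\<kappa>', \<gamma>') (\<kappa>, \<gamma>). (\<kappa>' \<circ> \<kappa>, \<lambda>a x. \<gamma>' (\<kappa> a) (\<gamma> a x)))"

definition weak_id :: "('a \<Rightarrow> 'a) \<times> ('a \<Rightarrow> 'k \<Rightarrow> 'k)" where
  "weak_id = (id, \<lambda>a x. x)"

definition weak_eq ::
    "('a, 'k) semi_bimodule \<Rightarrow> ('a \<Rightarrow> 'b) \<times> ('a \<Rightarrow> 'k \<Rightarrow> 'l) \<Rightarrow>
     ('a \<Rightarrow> 'b) \<times> ('a \<Rightarrow> 'k \<Rightarrow> 'l) \<Rightarrow> bool" where
  "weak_eq X f g \<longleftrightarrow>
     (\<forall>a\<in>carrier (csb_A X). fst f a = fst g a) \<and>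
     (\<forall>a\<in>carrier (csb_A X). \<forall>x\<in>carrier (csb_K X). snd f a x = snd g a x)"

definition weak_isomorphism ::
    "('a, 'k) semi_bimodule \<Rightarrow> ('b, 'l) semi_bimodule \<Rightarrow> ('a \<Rightarrow> 'b) \<times> ('a \<Rightarrow> 'k \<Rightarrow> 'l) \<Rightarrow> bool"
  where
  "weak_isomorphism X Y f \<longleftrightarrow>
     weak_morphism X Y f \<and>
     (\<exists>g. weak_morphism Y X g \<and>
          weak_eq X (weak_comp g f) weak_id \<and> weak_eq Y (weak_comp f g) weak_id)"

end

theory Submission
  imports Defs
begin

text \<open>
  Taking \<open>b = 1\<close> in \<open>circ_left\<close> gives \<open>a \<circ> (\<^sup>a x) = a \<partial>x\<close>, taking \<open>a = 1\<close> in \<open>circ_right\<close> gives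
  \<open>b \<circ> x\<^sup>b = \<partial>x b\<close>, and taking \<open>a = b = 1\<close> in \<open>interchange\<close> gives \<open>x \<diamond> y = x (\<^bsup>\<partial>x\<^esup> y)\<close>.
  The last formula makes the associativity of \<open>\<diamond>\<close> and the multiplicativity of \<open>\<partial>\<close> immediate, and
  the first two make \<open>\<partial>\<close> equivariant; the Peiffer identity is the comparison of the two
  formulas for \<open>\<diamond>\<close>.  The weak morphism laws for \<open>x \<mapsto> \<^sup>a x\<close> follow from the same three formulas.
  Since this map is bijective for each \<open>a\<close>, the inverse maps satisfy these laws too.
\<close>

section \<open>Crossed modules as crossed semi-bimodules\<close>

text \<open>With a trivial left action, \<open>circ_left\<close> is associativity in
  \<open>A\<close>, \<open>circ_right\<close> is the equivariance of \<open>\<delta>\<close>, and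
  \<open>interchange\<close> is the Peiffer identity applied to \<open>r x b\<close> and
  \<open>y\<close>.\<close>

lemma crossed_semi_bimodule_of_crossed_module:
  assumes "crossed_module G A \<delta> r"
  shows "crossed_semi_bimodule (csb_of_crossed_module G A \<delta> r)"
proof -
  interpret G: group G using assms by (simp add: crossed_module_def)
  interpret A: group A using assms by (simp add: crossed_module_def)
  have \<delta>: "\<delta> \<in> hom G A" and r: "right_monoid_action A G r"
    and equivariant: "\<And>x a. \<lbrakk>x \<in> carrier G; a \<in> carrier A\<rbrakk> \<Longrightarrow>
          \<delta> (r x a) = inv\<^bsub>A\<^esub> a \<otimes>\<^bsub>A\<^esub> \<delta> x \<otimes>\<^bsub>A\<^esub> a"
    and peiffer: "\<And>x y. \<lbrakk>x \<in> carrier G; y \<in> carrier G\<rbrakk> \<Longrightarrow>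
          r y (\<delta> x) = inv\<^bsub>G\<^esub> x \<otimes>\<^bsub>G\<^esub> y \<otimes>\<^bsub>G\<^esub> x"
    using assms by (auto simp: crossed_module_def)
  have \<delta>_closed: "\<And>x. x \<in> carrier G \<Longrightarrow> \<delta> x \<in> carrier A"
    and \<delta>_mult: "\<And>x y. \<lbrakk>x \<in> carrier G; y \<in> carrier G\<rbrakk> \<Longrightarrow> \<delta> (x \<otimes>\<^bsub>G\<^esub> y) = \<delta> x \<otimes>\<^bsub>A\<^esub> \<delta> y"
    using \<delta> by (auto simp: hom_def)
  have \<delta>_one: "\<delta> \<one>\<^bsub>G\<^esub> = \<one>\<^bsub>A\<^esub>"
    using \<delta> by (rule hom_one) unfold_locales
  have r_closed: "\<And>a x. \<lbrakk>a \<in> carrier A; x \<in> carrier G\<rbrakk> \<Longrightarrow> r x a \<in> carrier G"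
    and r_mult: "\<And>a b x. \<lbrakk>a \<in> carrier A; b \<in> carrier A; x \<in> carrier G\<rbrakk> \<Longrightarrow>
          r x (a \<otimes>\<^bsub>A\<^esub> b) = r (r x a) b"
    using r by (auto simp: right_monoid_action_def)
  \<comment> \<open>Both cancellation rules are right-nested, to match what \<open>m_assoc\<close>
    leaves once \<open>equivariant\<close> and \<open>peiffer\<close> are expanded.\<close>
  have cancel: "x \<otimes>\<^bsub>A\<^esub> (inv\<^bsub>A\<^esub> x \<otimes>\<^bsub>A\<^esub> y) = y" if "x \<in> carrier A" "y \<in> carrier A" for x y
    using that by (simp flip: A.m_assoc)
  have cancel': "x \<otimes>\<^bsub>G\<^esub> (inv\<^bsub>G\<^esub> x \<otimes>\<^bsub>G\<^esub> y) = y" if "x \<in> carrier G" "y \<in> carrier G" for x y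
    using that by (simp flip: G.m_assoc)
  show ?thesis
    unfolding csb_of_crossed_module_def
    by unfold_locales
       (use r in \<open>auto simp: right_set_def left_monoid_action_def \<delta>_closed \<delta>_mult \<delta>_one r_closed
          r_mult equivariant peiffer A.m_assoc G.m_assoc cancel cancel'\<close>)
qed

section \<open>Inverting weak morphisms with bijective components\<close>

text \<open>Each law for the inverse is the corresponding law of \<open>(\<kappa>, \<gamma>)\<close>
  at preimages, with \<open>\<kappa>'\<close> or \<open>\<gamma>'\<close> then applied to both
  sides.\<close>

lemma weak_isomorphismI:
  assumes mor: "weak_morphism X Y (\<kappa>, \<gamma>)"
    and \<kappa>: "bij_betw \<kappa> (carrier (csb_A X)) (carrier (csb_A Y))"
    and \<gamma>: "\<And>a. a \<in> carrier (csb_A X) \<Longrightarrow>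
              bij_betw (\<gamma> a) (carrier (csb_K X)) (carrier (csb_K Y))"
  shows "weak_isomorphism X Y (\<kappa>, \<gamma>)"
proof -
  define \<kappa>' where "\<kappa>' = inv_into (carrier (csb_A X)) \<kappa>"
  \<comment> \<open>The composition law evaluates \<open>\<gamma>'\<close> at
    \<open>\<kappa> a\<close>, so the component at \<open>b\<close> has to undo
    \<open>\<gamma>\<close> at the preimage \<open>\<kappa>' b\<close>.\<close>
  define \<gamma>' where "\<gamma>' b = inv_into (carrier (csb_K X)) (\<gamma> (\<kappa>' b))" for b
  interpret X: crossed_semi_bimodule X "csb_K X" "csb_A X"
    using mor by (simp add: weak_morphism_def)
  interpret Y: crossed_semi_bimodule Y "csb_K Y" "csb_A Y"
    using mor by (simp add: weak_morphism_def)
  have mult_A: "\<And>a b. \<lbrakk>a \<in> carrier (csb_A X); b \<in> carrier (csb_A X)\<rbrakk> \<Longrightarrow>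
      a \<otimes>\<^bsub>csb_A X\<^esub> b \<in> carrier (csb_A X)"
    and mult_K: "\<And>x y. \<lbrakk>x \<in> carrier (csb_K X); y \<in> carrier (csb_K X)\<rbrakk> \<Longrightarrow>
      x \<otimes>\<^bsub>csb_K X\<^esub> y \<in> carrier (csb_K X)"
    and one_A: "\<one>\<^bsub>csb_A X\<^esub> \<in> carrier (csb_A X)"
    using X.monoid_A X.monoid_K by (auto intro: monoid.m_closed monoid.one_closed)
  have circ_X: "\<And>a x. \<lbrakk>a \<in> carrier (csb_A X); x \<in> carrier (csb_K X)\<rbrakk> \<Longrightarrow>
      a \<odot>\<^bsub>X\<^esub> x \<in> carrier (csb_A X)"
    and left_X: "\<And>a x. \<lbrakk>a \<in> carrier (csb_A X); x \<in> carrier (csb_K X)\<rbrakk> \<Longrightarrow>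
      a \<triangleright>\<^bsub>X\<^esub> x \<in> carrier (csb_K X)"
    and right_X: "\<And>a x. \<lbrakk>a \<in> carrier (csb_A X); x \<in> carrier (csb_K X)\<rbrakk> \<Longrightarrow>
      x \<triangleleft>\<^bsub>X\<^esub> a \<in> carrier (csb_K X)"
    using X.circ_right_set X.left_action X.right_action
    by (auto simp: right_set_def left_monoid_action_def right_monoid_action_def)
  have hom: "\<And>a b. \<lbrakk>a \<in> carrier (csb_A X); b \<in> carrier (csb_A X)\<rbrakk> \<Longrightarrow>
      \<kappa> (a \<otimes>\<^bsub>csb_A X\<^esub> b) = \<kappa> a \<otimes>\<^bsub>csb_A Y\<^esub> \<kappa> b"
    and one: "\<kappa> \<one>\<^bsub>csb_A X\<^esub> = \<one>\<^bsub>csb_A Y\<^esub>"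
    and w1: "\<And>a x y. \<lbrakk>a \<in> carrier (csb_A X); x \<in> carrier (csb_K X); y \<in> carrier (csb_K X)\<rbrakk> \<Longrightarrow>
      \<gamma> a (x \<otimes>\<^bsub>csb_K X\<^esub> y) = \<gamma> a x \<otimes>\<^bsub>csb_K Y\<^esub> \<gamma> (a \<odot>\<^bsub>X\<^esub> x) y"
    and w2: "\<And>a x. \<lbrakk>a \<in> carrier (csb_A X); x \<in> carrier (csb_K X)\<rbrakk> \<Longrightarrow>
      \<kappa> a \<odot>\<^bsub>Y\<^esub> \<gamma> a x = \<kappa> (a \<odot>\<^bsub>X\<^esub> x)"
    and w3: "\<And>a b x y. \<lbrakk>a \<in> carrier (csb_A X); b \<in> carrier (csb_A X);
      x \<in> carrier (csb_K X); y \<in> carrier (csb_K X)\<rbrakk> \<Longrightarrow>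
      (\<kappa> a \<triangleright>\<^bsub>Y\<^esub> \<gamma> b y) \<otimes>\<^bsub>csb_K Y\<^esub> (\<gamma> a x \<triangleleft>\<^bsub>Y\<^esub> (\<kappa> b \<odot>\<^bsub>Y\<^esub> \<gamma> b y)) =
        \<gamma> (a \<otimes>\<^bsub>csb_A X\<^esub> b) ((a \<triangleright>\<^bsub>X\<^esub> y) \<otimes>\<^bsub>csb_K X\<^esub> (x \<triangleleft>\<^bsub>X\<^esub> (b \<odot>\<^bsub>X\<^esub> y)))"
    using mor by (auto simp: weak_morphism_def hom_def)
  have \<kappa>'_closed: "\<kappa>' b \<in> carrier (csb_A X)" and \<kappa>_\<kappa>': "\<kappa> (\<kappa>' b) = b"
    if "b \<in> carrier (csb_A Y)" for b
    using \<kappa> that unfolding \<kappa>'_def bij_betw_def by (auto intro: inv_into_into f_inv_into_f)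
  have \<kappa>'_\<kappa>: "\<kappa>' (\<kappa> a) = a" if "a \<in> carrier (csb_A X)" for a
    using \<kappa> that unfolding \<kappa>'_def bij_betw_def by auto
  have \<gamma>'_closed: "\<gamma>' b x \<in> carrier (csb_K X)" and \<gamma>_\<gamma>': "\<gamma> (\<kappa>' b) (\<gamma>' b x) = x"
    if "b \<in> carrier (csb_A Y)" "x \<in> carrier (csb_K Y)" for b x
    using \<gamma>[OF \<kappa>'_closed[OF that(1)]] that(2) unfolding \<gamma>'_def bij_betw_def
    by (auto intro: inv_into_into f_inv_into_f)
  have \<gamma>'_\<gamma>: "\<gamma>' (\<kappa> a) (\<gamma> a x) = x"
    if "a \<in> carrier (csb_A X)" "x \<in> carrier (csb_K X)" for a x
    using \<gamma>[OF that(1)] that unfolding \<gamma>'_def bij_betw_def by (simp add: \<kappa>'_\<kappa>)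
  have \<kappa>'_mult: "\<kappa>' (a \<otimes>\<^bsub>csb_A Y\<^esub> b) = \<kappa>' a \<otimes>\<^bsub>csb_A X\<^esub> \<kappa>' b"
    if "a \<in> carrier (csb_A Y)" "b \<in> carrier (csb_A Y)" for a b
    using hom[of "\<kappa>' a" "\<kappa>' b"] \<kappa>'_\<kappa>[of "\<kappa>' a \<otimes>\<^bsub>csb_A X\<^esub> \<kappa>' b"] that
    by (simp add: \<kappa>'_closed \<kappa>_\<kappa>' mult_A)
  have \<kappa>'_one: "\<kappa>' \<one>\<^bsub>csb_A Y\<^esub> = \<one>\<^bsub>csb_A X\<^esub>"
    using \<kappa>'_\<kappa>[OF one_A] one by simp
  have w2': "\<kappa>' a \<odot>\<^bsub>X\<^esub> \<gamma>' a x = \<kappa>' (a \<odot>\<^bsub>Y\<^esub> x)"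
    if "a \<in> carrier (csb_A Y)" "x \<in> carrier (csb_K Y)" for a x
    using w2[of "\<kappa>' a" "\<gamma>' a x"] \<kappa>'_\<kappa>[of "\<kappa>' a \<odot>\<^bsub>X\<^esub> \<gamma>' a x"] that
    by (simp add: \<kappa>'_closed \<kappa>_\<kappa>' \<gamma>'_closed \<gamma>_\<gamma>' circ_X)
  have circ_Y: "a \<odot>\<^bsub>Y\<^esub> x \<in> carrier (csb_A Y)"
    if "a \<in> carrier (csb_A Y)" "x \<in> carrier (csb_K Y)" for a x
    using Y.circ_right_set that by (simp add: right_set_def)
  \<comment> \<open>The second factor in \<open>w1\<close> is based at
    \<open>\<kappa>' a \<odot> \<gamma>' a x\<close>; \<open>w2'\<close> identifies this with
    \<open>\<kappa>' (a \<odot> x)\<close>, where \<open>\<gamma>\<close> cancels the chosen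
    \<open>\<gamma>' (a \<odot> x) y\<close>.\<close>
  have w1': "\<gamma>' a (x \<otimes>\<^bsub>csb_K Y\<^esub> y) = \<gamma>' a x \<otimes>\<^bsub>csb_K X\<^esub> \<gamma>' (a \<odot>\<^bsub>Y\<^esub> x) y"
    if "a \<in> carrier (csb_A Y)" "x \<in> carrier (csb_K Y)" "y \<in> carrier (csb_K Y)" for a x y
    using w1[of "\<kappa>' a" "\<gamma>' a x" "\<gamma>' (a \<odot>\<^bsub>Y\<^esub> x) y"]
      \<gamma>'_\<gamma>[of "\<kappa>' a" "\<gamma>' a x \<otimes>\<^bsub>csb_K X\<^esub> \<gamma>' (a \<odot>\<^bsub>Y\<^esub> x) y"] that
    by (simp add: \<kappa>'_closed \<kappa>_\<kappa>' \<gamma>'_closed \<gamma>_\<gamma>' circ_Y mult_K w2')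
  \<comment> \<open>The exponent is already in the form \<open>\<kappa>' (b \<odot> y)\<close> to
    which \<open>w2'\<close> rewrites the one in the law.\<close>
  have w3': "(\<kappa>' a \<triangleright>\<^bsub>X\<^esub> \<gamma>' b y) \<otimes>\<^bsub>csb_K X\<^esub> (\<gamma>' a x \<triangleleft>\<^bsub>X\<^esub> \<kappa>' (b \<odot>\<^bsub>Y\<^esub> y)) =
      \<gamma>' (a \<otimes>\<^bsub>csb_A Y\<^esub> b) ((a \<triangleright>\<^bsub>Y\<^esub> y) \<otimes>\<^bsub>csb_K Y\<^esub> (x \<triangleleft>\<^bsub>Y\<^esub> (b \<odot>\<^bsub>Y\<^esub> y)))"
    if "a \<in> carrier (csb_A Y)" "b \<in> carrier (csb_A Y)"
      "x \<in> carrier (csb_K Y)" "y \<in> carrier (csb_K Y)" for a b x y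
  proof -
    let ?z = "(\<kappa>' a \<triangleright>\<^bsub>X\<^esub> \<gamma>' b y) \<otimes>\<^bsub>csb_K X\<^esub> (\<gamma>' a x \<triangleleft>\<^bsub>X\<^esub> \<kappa>' (b \<odot>\<^bsub>Y\<^esub> y))"
    have "?z \<in> carrier (csb_K X)"
      using that by (simp add: \<kappa>'_closed \<gamma>'_closed circ_Y left_X right_X mult_K)
    moreover have "\<gamma> (\<kappa>' a \<otimes>\<^bsub>csb_A X\<^esub> \<kappa>' b) ?z =
        (a \<triangleright>\<^bsub>Y\<^esub> y) \<otimes>\<^bsub>csb_K Y\<^esub> (x \<triangleleft>\<^bsub>Y\<^esub> (b \<odot>\<^bsub>Y\<^esub> y))"
      using w3[of "\<kappa>' a" "\<kappa>' b" "\<gamma>' a x" "\<gamma>' b y"] that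
      by (simp add: \<kappa>'_closed \<kappa>_\<kappa>' \<gamma>'_closed \<gamma>_\<gamma>' w2')
    ultimately show ?thesis
      using \<gamma>'_\<gamma>[of "\<kappa>' a \<otimes>\<^bsub>csb_A X\<^esub> \<kappa>' b" ?z] that
      by (simp add: hom \<kappa>'_closed \<kappa>_\<kappa>' mult_A)
  qed
  have "weak_morphism Y X (\<kappa>', \<gamma>')"
    unfolding weak_morphism_def
    using X.crossed_semi_bimodule_axioms Y.crossed_semi_bimodule_axioms
    by (auto simp: hom_def \<kappa>'_closed \<kappa>'_mult \<kappa>'_one \<gamma>'_closed w1' w2' w3')
  moreover have "weak_eq X (weak_comp (\<kappa>', \<gamma>') (\<kappa>, \<gamma>)) weak_id"
    by (simp add: weak_eq_def weak_comp_def weak_id_def \<kappa>'_\<kappa> \<gamma>'_\<gamma>)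
  moreover have "weak_eq Y (weak_comp (\<kappa>, \<gamma>) (\<kappa>', \<gamma>')) weak_id"
    by (simp add: weak_eq_def weak_comp_def weak_id_def \<kappa>_\<kappa>' \<gamma>_\<gamma>')
  ultimately show ?thesis
    using mor unfolding weak_isomorphism_def by blast
qed

section \<open>Crossed semi-bimodules of groups\<close>

locale crossed_group_bimodule = crossed_semi_bimodule +
  assumes group_K: "group K" and group_A: "group A"
begin

sublocale K: group K by (rule group_K)
sublocale A: group A by (rule group_A)

abbreviation bd :: "'b \<Rightarrow> 'a" where "bd \<equiv> csb_boundary X"

lemma
  assumes "a \<in> carrier A" "x \<in> carrier K"
  shows circ_closed [simp]: "a \<odot> x \<in> carrier A"
    and left_closed [simp]: "a \<triangleright> x \<in> carrier K"
    and right_closed [simp]: "x \<triangleleft> a \<in> carrier K"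
  using assms circ_right_set left_action right_action
  by (simp_all add: right_set_def left_monoid_action_def right_monoid_action_def)

lemma
  assumes "x \<in> carrier K"
  shows left_one: "\<one>\<^bsub>A\<^esub> \<triangleright> x = x"
    and right_one: "x \<triangleleft> \<one>\<^bsub>A\<^esub> = x"
  using assms left_action right_action
  by (simp_all add: left_monoid_action_def right_monoid_action_def)

lemma
  assumes "a \<in> carrier A"
  shows circ_unit: "a \<odot> \<one>\<^bsub>K\<^esub> = a"
    and left_unit: "a \<triangleright> \<one>\<^bsub>K\<^esub> = \<one>\<^bsub>K\<^esub>"
    and right_unit: "\<one>\<^bsub>K\<^esub> \<triangleleft> a = \<one>\<^bsub>K\<^esub>"
  using assms circ_right_set left_action right_action
  by (simp_all add: right_set_def left_monoid_action_def right_monoid_action_def)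

lemma
  assumes "a \<in> carrier A" "b \<in> carrier A" "x \<in> carrier K"
  shows left_left: "a \<triangleright> (b \<triangleright> x) = (a \<otimes>\<^bsub>A\<^esub> b) \<triangleright> x"
    and right_right: "(x \<triangleleft> a) \<triangleleft> b = x \<triangleleft> (a \<otimes>\<^bsub>A\<^esub> b)"
  using assms left_action right_action
  by (simp_all add: left_monoid_action_def right_monoid_action_def)

lemma
  assumes "a \<in> carrier A" "x \<in> carrier K" "y \<in> carrier K"
  shows left_mult: "a \<triangleright> (x \<otimes>\<^bsub>K\<^esub> y) = (a \<triangleright> x) \<otimes>\<^bsub>K\<^esub> (a \<triangleright> y)"
    and right_mult: "(x \<otimes>\<^bsub>K\<^esub> y) \<triangleleft> a = (x \<triangleleft> a) \<otimes>\<^bsub>K\<^esub> (y \<triangleleft> a)"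
    and circ_mult: "a \<odot> (x \<otimes>\<^bsub>K\<^esub> y) = a \<odot> x \<odot> y"
  using assms circ_right_set left_action right_action
  by (simp_all add: right_set_def left_monoid_action_def right_monoid_action_def)

lemma bd_eq: "bd x = \<one>\<^bsub>A\<^esub> \<odot> x"
  by (simp add: csb_boundary_def A_def)

lemma bd_closed [simp]: "x \<in> carrier K \<Longrightarrow> bd x \<in> carrier A"
  by (simp add: bd_eq)

text \<open>This is also the second weak morphism law for the maps
  \<open>x \<mapsto> a \<triangleright> x\<close> out of the twist.\<close>

lemma circ_left_eq: "\<lbrakk>a \<in> carrier A; x \<in> carrier K\<rbrakk> \<Longrightarrow> a \<odot> (a \<triangleright> x) = a \<otimes>\<^bsub>A\<^esub> bd x"
  using circ_left[of a "\<one>\<^bsub>A\<^esub>" x] by (simp add: bd_eq)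

lemma circ_right_eq: "\<lbrakk>a \<in> carrier A; x \<in> carrier K\<rbrakk> \<Longrightarrow> a \<odot> (x \<triangleleft> a) = bd x \<otimes>\<^bsub>A\<^esub> a"
  using circ_right[of "\<one>\<^bsub>A\<^esub>" a x] by (simp add: bd_eq)

section \<open>The twisted group and its boundary map\<close>

lemma carrier_twist [simp]: "carrier (csb_twist X) = carrier K"
  and one_twist [simp]: "\<one>\<^bsub>csb_twist X\<^esub> = \<one>\<^bsub>K\<^esub>"
  and mult_twist: "x \<otimes>\<^bsub>csb_twist X\<^esub> y = y \<otimes>\<^bsub>K\<^esub> (x \<triangleleft> bd y)"
  by (simp_all add: csb_twist_def K_def)

lemma mult_twist':
  assumes "x \<in> carrier K" "y \<in> carrier K"
  shows "x \<otimes>\<^bsub>csb_twist X\<^esub> y = x \<otimes>\<^bsub>K\<^esub> (bd x \<triangleright> y)"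
  using interchange[of "\<one>\<^bsub>A\<^esub>" "\<one>\<^bsub>A\<^esub>" x y] assms
  by (simp add: mult_twist bd_eq left_one right_one)

lemma bd_one: "bd \<one>\<^bsub>K\<^esub> = \<one>\<^bsub>A\<^esub>"
  by (simp add: bd_eq circ_unit)

text \<open>In the left form of the product, acting on the unit first by \<open>x\<close> gives
  \<open>bd x\<close>, and \<open>circ_left_eq\<close> evaluates the action of the remaining
  factor.\<close>

lemma bd_mult_twist:
  assumes "x \<in> carrier K" "y \<in> carrier K"
  shows "bd (x \<otimes>\<^bsub>csb_twist X\<^esub> y) = bd x \<otimes>\<^bsub>A\<^esub> bd y"
proof -
  have "bd (x \<otimes>\<^bsub>csb_twist X\<^esub> y) = bd x \<odot> (bd x \<triangleright> y)"
    using assms by (simp add: mult_twist' bd_eq circ_mult)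
  then show ?thesis
    using assms by (simp add: circ_left_eq)
qed

text \<open>Both bracketings of a triple product equal the product in \<open>K\<close> of
  \<open>x\<close>, \<open>bd x \<triangleright> y\<close> and
  \<open>(bd x \<otimes> bd y) \<triangleright> z\<close>.\<close>

lemma group_twist: "group (csb_twist X)"
proof (rule groupI)
  fix x y z
  assume xyz: "x \<in> carrier (csb_twist X)" "y \<in> carrier (csb_twist X)" "z \<in> carrier (csb_twist X)"
  have "x \<otimes>\<^bsub>csb_twist X\<^esub> y \<in> carrier K"
    using xyz by (simp add: mult_twist')
  with xyz have "x \<otimes>\<^bsub>csb_twist X\<^esub> y \<otimes>\<^bsub>csb_twist X\<^esub> z =
      (x \<otimes>\<^bsub>csb_twist X\<^esub> y) \<otimes>\<^bsub>K\<^esub> ((bd x \<otimes>\<^bsub>A\<^esub> bd y) \<triangleright> z)"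
    using mult_twist'[of "x \<otimes>\<^bsub>csb_twist X\<^esub> y" z] by (simp add: bd_mult_twist)
  with xyz show "x \<otimes>\<^bsub>csb_twist X\<^esub> y \<otimes>\<^bsub>csb_twist X\<^esub> z =
      x \<otimes>\<^bsub>csb_twist X\<^esub> (y \<otimes>\<^bsub>csb_twist X\<^esub> z)"
    by (simp add: mult_twist' left_mult left_left K.m_assoc)
next
  fix x assume x: "x \<in> carrier (csb_twist X)"
  \<comment> \<open>The left inverse comes from the right form of the product:
    \<open>x \<otimes> (y \<triangleleft> bd x)\<close> is the unit of \<open>K\<close> exactly when
    \<open>y \<triangleleft> bd x\<close> is the inverse of \<open>x\<close> in
    \<open>K\<close>.\<close>
  let ?y = "(inv\<^bsub>K\<^esub> x) \<triangleleft> (inv\<^bsub>A\<^esub> (bd x))"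
  have "?y \<in> carrier (csb_twist X)" "?y \<otimes>\<^bsub>csb_twist X\<^esub> x = \<one>\<^bsub>csb_twist X\<^esub>"
    using x by (simp_all add: mult_twist right_right right_one)
  then show "\<exists>y\<in>carrier (csb_twist X). y \<otimes>\<^bsub>csb_twist X\<^esub> x = \<one>\<^bsub>csb_twist X\<^esub>"
    by blast
qed (auto simp: mult_twist' bd_one left_one)

section \<open>The crossed module structure of the twist\<close>

abbreviation conj_action :: "'b \<Rightarrow> 'a \<Rightarrow> 'b" where "conj_action \<equiv> csb_twist_action X"

lemma twist_action_eq: "conj_action x a = (inv\<^bsub>A\<^esub> a) \<triangleright> (x \<triangleleft> a)"
  by (simp add: csb_twist_action_def A_def)

lemma left_twist_action:
  assumes "x \<in> carrier K" "a \<in> carrier A"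
  shows "a \<triangleright> conj_action x a = x \<triangleleft> a"
  using assms by (simp add: twist_action_eq left_left left_one)

lemma twist_action_closed [simp]:
  "\<lbrakk>x \<in> carrier K; a \<in> carrier A\<rbrakk> \<Longrightarrow> conj_action x a \<in> carrier K"
  by (simp add: twist_action_eq)

text \<open>The elements \<open>a \<triangleright> conj_action x a\<close> and
  \<open>x \<triangleleft> a\<close> coincide; letting them act on \<open>a\<close> and evaluating
  by \<open>circ_left_eq\<close> and \<open>circ_right_eq\<close> gives two expressions to
  compare.\<close>

lemma bd_twist_action:
  assumes "x \<in> carrier K" "a \<in> carrier A"
  shows "bd (conj_action x a) = inv\<^bsub>A\<^esub> a \<otimes>\<^bsub>A\<^esub> bd x \<otimes>\<^bsub>A\<^esub> a"
proof -
  have "a \<otimes>\<^bsub>A\<^esub> bd (conj_action x a) = bd x \<otimes>\<^bsub>A\<^esub> a"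
    using assms circ_left_eq[of a "conj_action x a"] circ_right_eq[of a x]
    by (simp add: left_twist_action)
  then show ?thesis
    using assms by (simp add: A.inv_solve_left A.m_assoc)
qed

lemma twist_action_mult:
  assumes "x \<in> carrier K" "y \<in> carrier K" "a \<in> carrier A"
  shows "conj_action (x \<otimes>\<^bsub>csb_twist X\<^esub> y) a =
    conj_action x a \<otimes>\<^bsub>csb_twist X\<^esub> conj_action y a"
proof -
  \<comment> \<open>Equivariance in this form turns the total exponent
    \<open>a \<otimes> bd (conj_action y a)\<close> of \<open>x\<close> on the right-hand side into
    the exponent \<open>bd y \<otimes> a\<close> found on the left.\<close>
  have "a \<otimes>\<^bsub>A\<^esub> bd (conj_action y a) = bd y \<otimes>\<^bsub>A\<^esub> a"
    using assms by (simp add: bd_twist_action flip: A.m_assoc)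
  then show ?thesis
    using assms
    \<comment> \<open>The action on \<open>y\<close> stays folded so that the equation above can
      match inside \<open>bd\<close>.\<close>
    by (simp add: mult_twist twist_action_eq[of "_ \<otimes>\<^bsub>K\<^esub> _"] twist_action_eq[of x]
        twist_action_eq[of y a, symmetric] left_mult right_mult right_right actions_commute)
qed

text \<open>The left form of \<open>x\<close> times \<open>conj_action y (bd x)\<close> and the
  right form of \<open>y\<close> times \<open>x\<close> in the twist are both
  \<open>x \<otimes> (y \<triangleleft> bd x)\<close>.\<close>

lemma peiffer_identity:
  assumes "x \<in> carrier K" "y \<in> carrier K"
  shows "conj_action y (bd x) =
    inv\<^bsub>csb_twist X\<^esub> x \<otimes>\<^bsub>csb_twist X\<^esub> y \<otimes>\<^bsub>csb_twist X\<^esub> x"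
proof -
  interpret T: group "csb_twist X" by (rule group_twist)
  have "x \<otimes>\<^bsub>csb_twist X\<^esub> conj_action y (bd x) = y \<otimes>\<^bsub>csb_twist X\<^esub> x"
    using assms mult_twist'[of x "conj_action y (bd x)"] mult_twist[of y x]
    by (simp add: left_twist_action)
  then show ?thesis
    using assms T.inv_solve_left[of "conj_action y (bd x)" x "y \<otimes>\<^bsub>csb_twist X\<^esub> x"]
      T.m_closed[of y x] T.inv_closed[of x]
    by (simp add: T.m_assoc)
qed

lemma crossed_module_twist: "crossed_module (csb_twist X) A bd conj_action"
proof -
  have "right_monoid_action A (csb_twist X) conj_action"
    unfolding right_monoid_action_def
  proof (intro conjI ballI)
    fix a b x
    assume "a \<in> carrier A" "b \<in> carrier A" "x \<in> carrier (csb_twist X)"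
    then show "conj_action x (a \<otimes>\<^bsub>A\<^esub> b) = conj_action (conj_action x a) b"
      by (simp add: twist_action_eq actions_commute left_left right_right A.inv_mult_group)
  \<comment> \<open>Multiplicativity is settled first, before \<open>twist_action_eq\<close> unfolds
    the action.\<close>
  qed (simp_all add: twist_action_mult,
       simp_all add: twist_action_eq left_one right_one left_unit right_unit)
  moreover have "bd \<in> hom (csb_twist X) A"
    by (simp add: hom_def bd_mult_twist)
  ultimately show ?thesis
    by (simp add: crossed_module_def group_twist A.group_axioms bd_twist_action
        peiffer_identity)
qed

section \<open>The weak isomorphism from the twist\<close>

abbreviation XT where "XT \<equiv> csb_of_crossed_module (csb_twist X) A bd conj_action"

lemma weak_morphism_left: "weak_morphism XT X (id, csb_left X)"
proof -
  have w1: "a \<triangleright> (x \<otimes>\<^bsub>csb_twist X\<^esub> y) = (a \<triangleright> x) \<otimes>\<^bsub>K\<^esub> ((a \<otimes>\<^bsub>A\<^esub> bd x) \<triangleright> y)"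
    if "a \<in> carrier A" "x \<in> carrier K" "y \<in> carrier K" for a x y
    using that by (simp add: mult_twist' left_mult left_left)
  have w3: "(a \<triangleright> (b \<triangleright> y)) \<otimes>\<^bsub>K\<^esub> ((a \<triangleright> x) \<triangleleft> (b \<odot> (b \<triangleright> y))) =
      (a \<otimes>\<^bsub>A\<^esub> b) \<triangleright> (y \<otimes>\<^bsub>csb_twist X\<^esub> conj_action x (b \<otimes>\<^bsub>A\<^esub> bd y))"
    if "a \<in> carrier A" "b \<in> carrier A" "x \<in> carrier K" "y \<in> carrier K" for a b x y
  proof -
    \<comment> \<open>Expanding the right-hand side by the left form of the product makes this
      element act on \<open>x \<triangleleft> (b \<otimes> bd y)\<close>; its collapse to
      \<open>a\<close> gives the second factor on the left.\<close>
    have "(a \<otimes>\<^bsub>A\<^esub> b) \<otimes>\<^bsub>A\<^esub> (bd y \<otimes>\<^bsub>A\<^esub> inv\<^bsub>A\<^esub> (b \<otimes>\<^bsub>A\<^esub> bd y)) = a"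
      using that A.m_assoc[of a "b \<otimes>\<^bsub>A\<^esub> bd y" "inv\<^bsub>A\<^esub> (b \<otimes>\<^bsub>A\<^esub> bd y)"] A.m_assoc[of a b "bd y"]
        A.m_assoc[of "a \<otimes>\<^bsub>A\<^esub> b" "bd y" "inv\<^bsub>A\<^esub> (b \<otimes>\<^bsub>A\<^esub> bd y)"]
      by simp
    then show ?thesis
      using that by (simp add: circ_left_eq mult_twist' left_mult left_left twist_action_eq
          actions_commute)
  qed
  show ?thesis
    unfolding weak_morphism_def
    using crossed_semi_bimodule_of_crossed_module[OF crossed_module_twist]
      crossed_semi_bimodule_axioms w1 w3
    by (simp add: csb_of_crossed_module_def hom_def circ_left_eq flip: A_def K_def)
qed

lemma bij_betw_left:
  assumes "a \<in> carrier A"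
  shows "bij_betw (\<lambda>x. a \<triangleright> x) (carrier K) (carrier K)"
  by (rule bij_betw_byWitness[where f' = "\<lambda>x. (inv\<^bsub>A\<^esub> a) \<triangleright> x"])
     (use assms in \<open>auto simp: left_left left_one\<close>)

lemma weak_isomorphism_left: "weak_isomorphism XT X (id, csb_left X)"
  using weak_morphism_left
  by (rule weak_isomorphismI)
     (simp_all add: csb_of_crossed_module_def bij_betw_left flip: A_def K_def)

end

text \<open>The first conjunct certifies that the domain of the weak isomorphism really arises from
  a crossed module.\<close>

theorem proposition5p5:
  fixes X :: "('a, 'k) semi_bimodule"
  assumes "crossed_semi_bimodule X"
    and "group (csb_K X)"
    and "group (csb_A X)"
  shows "crossed_module (csb_twist X) (csb_A X) (csb_boundary X) (csb_twist_action X) \<and>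
    weak_isomorphism
      (csb_of_crossed_module (csb_twist X) (csb_A X) (csb_boundary X) (csb_twist_action X))
      X
      (id, \<lambda>a x. a \<triangleright>\<^bsub>X\<^esub> x)"
proof -
  interpret crossed_group_bimodule X "csb_K X" "csb_A X"
    using assms by (simp add: crossed_group_bimodule_def crossed_group_bimodule_axioms_def)
  show ?thesis
    using crossed_module_twist weak_isomorphism_left by blast
qed

end
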